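(* Let $n\geq 2$, let $\mathcal{L}=\{x\in\mathbb{R}^n : x_1\geq\sqrt{x_2^2+\dots+x_n^2}\}$ be the Lorentz cone, let $\mathcal{C}=\operatorname{int}(\mathcal{L})\cap\mathbb{S}$, and let $f:\mathcal{C}\to\mathbb{R}$ be defined by $f(x)=\langle Ax,x\rangle$, where $A=A^T\in\mathbb{R}^{n\times n}$. Then $f$ is spherically convex if and only if there exist $a,\lambda\in\mathbb{R}$ with $\lambda\geq a$ such that $A=\operatorname{diag}(a,\lambda I_{n-1})$.
   Context: $\mathbb{R}^n$ carries the canonical inner product $\langle\cdot,\cdot\rangle$ and norm $\|\cdot\|$; $\mathbb{S}=\{x\in\mathbb{R}^n:\|x\|=1\}$ is the unit sphere; $\operatorname{int}$ denotes topological interior; $I_{n-1}$ is the $(n-1)\times(n-1)$ identity matrix. For $a\in\mathbb{R}$ and $B\in\mathbb{R}^{(n-1)\times(n-1)}$, $\operatorname{diag}(a,B)=\begin{bmatrix}a&0\\0&B\end{bmatrix}\in\mathbb{R}^{n\times n}$. A geodesic of $\mathbb{S}$ is the intersection curve of a plane through the origin with $\mathbb{S}$, parameterized with constant speed; a geodesic segment $\gamma:[a,b]\to\mathbb{S}$ is minimal if its arc length equals $\arccos\langle\gamma(a),\gamma(b)\rangle$. A set $C\subseteq\mathbb{S}$ is spherically convex if for any $x,y\in C$ all minimal geodesic segments joining $x$ to $y$ are contained in $C$. For a spherically convex set $C$, a function $f:C\to\mathbb{R}$ is spherically convex if for every minimal geodesic segment $\gamma:I\to C$ ($I\subset\mathbb{R}$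 an interval) the composition $f\circ\gamma:I\to\mathbb{R}$ is convex in the usual sense. *)

theory Defs
  imports "HOL-Analysis.Analysis"
begin

text \<open>
  The arc length of a continuously differentiable curve on \<open>{a..b}\<close>. The derivative is taken
  within the interval, so values of the curve outside \<open>{a..b}\<close> play no role.
\<close>

definition arc_length :: "real \<Rightarrow> real \<Rightarrow> (real \<Rightarrow> 'a::euclidean_space) \<Rightarrow> real" where
  "arc_length a b \<gamma> =
     integral {a..b} (\<lambda>t. norm (vector_derivative \<gamma> (at t within {a..b})))"

text \<open>
  A continuously differentiable, constant-speed curve running in the intersection of the unit
  sphere with a plane through the origin. Constant curves (speed 0) and one-point parameter
  intervals are admitted.
\<close>

definition geodesic_segment :: "real \<Rightarrow> real \<Rightarrow> (real \<Rightarrow> 'a::euclidean_space) \<Rightarrow> bool" where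
  "geodesic_segment a b \<gamma> \<longleftrightarrow>
     a \<le> b \<and>
     (\<exists>P. subspace P \<and> dim P = 2 \<and> \<gamma> ` {a..b} \<subseteq> P \<inter> sphere 0 1) \<and>
     (\<exists>\<gamma>' c. continuous_on {a..b} \<gamma>' \<and>
        (\<forall>t\<in>{a..b}. (\<gamma> has_vector_derivative \<gamma>' t) (at t within {a..b}) \<and> norm (\<gamma>' t) = c))"

definition minimal_geodesic_segment ::
  "real \<Rightarrow> real \<Rightarrow> (real \<Rightarrow> 'a::euclidean_space) \<Rightarrow> bool" where
  "minimal_geodesic_segment a b \<gamma> \<longleftrightarrow>
     geodesic_segment a b \<gamma> \<and> arc_length a b \<gamma> = arccos (\<gamma> a \<bullet> \<gamma> b)"

definition spherically_convex :: "'a::euclidean_space set \<Rightarrow> bool" where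
  "spherically_convex C \<longleftrightarrow>
     C \<subseteq> sphere 0 1 \<and>
     (\<forall>x\<in>C. \<forall>y\<in>C. \<forall>a b \<gamma>.
        minimal_geodesic_segment a b \<gamma> \<and> \<gamma> a = x \<and> \<gamma> b = y \<longrightarrow> \<gamma> ` {a..b} \<subseteq> C)"

text \<open>As for \<^const>\<open>convex_on\<close>, convexity of the domain is part of the definition.\<close>

definition spherically_convex_on :: "'a::euclidean_space set \<Rightarrow> ('a \<Rightarrow> real) \<Rightarrow> bool" where
  "spherically_convex_on C f \<longleftrightarrow>
     spherically_convex C \<and>
     (\<forall>a b \<gamma>. minimal_geodesic_segment a b \<gamma> \<and> \<gamma> ` {a..b} \<subseteq> C \<longrightarrow> convex_on {a..b} (f \<circ> \<gamma>))"

text \<open>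
  Vectors of length \<open>n\<close> are indexed by \<^typ>\<open>'m option\<close> with \<open>'m\<close> finite: \<^const>\<open>None\<close> is the
  first coordinate and \<open>Some i\<close> are the remaining \<open>n - 1 = CARD('m)\<close> ones. Types being nonempty,
  \<open>n \<ge> 2\<close> holds automatically, and every \<open>n \<ge> 2\<close> arises in this way.
\<close>

lemma CARD_option_ge_2: "CARD('m::finite option) = CARD('m) + 1" "CARD('m option) \<ge> 2"
  using zero_less_card_finite[where 'a = 'm] by simp_all

definition lorentz_cone :: "(real ^ ('m::finite option)) set" where
  "lorentz_cone = {x. x $ None \<ge> sqrt (\<Sum>i\<in>UNIV. (x $ Some i)\<^sup>2)}"

definition block_diag ::
  "real \<Rightarrow> real ^ 'm ^ 'm \<Rightarrow> real ^ ('m::finite option) ^ ('m option)" where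
  "block_diag a B =
     (\<chi> i j. case (i, j) of
        (None, None) \<Rightarrow> a
      | (Some i', Some j') \<Rightarrow> B $ i' $ j'
      | _ \<Rightarrow> 0)"

end

theory Submission
  imports Defs
begin

text \<open>
  Write \<open>e\<close> for the first basis vector and \<open>H\<close> for its orthogonal complement. Geodesics are
  understood through explicit arcs: a geodesic segment is
  \<open>t \<mapsto> cos (w (t - a)) x + sin (w (t - a)) y\<close> for some orthonormal \<open>x\<close>, \<open>y\<close> and \<open>w \<ge> 0\<close>
  (\<open>geodesic_segment_circular_arc\<close>), and conversely every unit-speed arc of this kind of length at
  most \<open>\<pi>\<close> is a minimal geodesic segment (\<open>great_circle_arc_minimal\<close>).

  If \<open>A = diag(a, \<lambda> I)\<close>, then \<open>f(x) = \<lambda> - (\<lambda> - a) x\<^sub>1\<^sup>2\<close> on the sphere, so it is enough that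
  \<open>x\<^sub>1\<^sup>2\<close> is concave along geodesics. This is where the opening angle of the cone enters: the
  points of the domain are exactly those with \<open>x\<^sub>1 > 1/\<surd>2\<close>, and there the first coordinate dominates
  its own derivative (\<open>neg_square_first_coordinate_convex_on\<close>).

  Conversely, the second derivative of \<open>f\<close> along geodesics through a point \<open>p\<close> of the domain gives
  \<open>\<langle>Ap,p\<rangle> \<le> \<langle>Aq,q\<rangle>\<close> for every unit vector \<open>q\<close> orthogonal to \<open>p\<close>. By continuity this extends to
  \<open>p\<close> on the boundary of the cone (\<open>spherically_convex_on_boundary_pair\<close>). For a unit vector
  \<open>u \<in> H\<close> the orthogonal vectors \<open>e + u\<close> and \<open>e - u\<close> both lie on that boundary, so the
  quadratic form takes the same value on both, which means \<open>\<langle>Ae,u\<rangle> = 0\<close>. Moreover \<open>e - u\<close> then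
  minimizes the form relative to the squared norm among all directions \<open>e - u + t v\<close> with \<open>v \<in> H\<close>
  orthogonal to \<open>u\<close>, and the vanishing first variation means \<open>\<langle>Au,v\<rangle> = 0\<close>. A symmetric form on
  \<open>H\<close> that vanishes on all orthogonal pairs is a multiple of the inner product, and
  comparing \<open>e\<close> with a vector of \<open>H\<close> gives \<open>a \<le> \<lambda>\<close>.
\<close>

section \<open>Geodesic segments are circular arcs\<close>

lemma subspace_dim_2_orthonormal_frame:
  fixes P :: "'a::euclidean_space set"
  assumes P: "subspace P" "dim P = 2" and x: "x \<in> P" "norm x = 1"
  obtains e where "norm e = 1" "x \<bullet> e = 0"
    "\<And>y. y \<in> P \<Longrightarrow> y = (y \<bullet> x) *\<^sub>R x + (y \<bullet> e) *\<^sub>R e"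
proof -
  have "span {x} \<subseteq> P"
    using P x by (simp add: span_minimal)
  moreover have "dim (span {x}) \<le> 1"
    using dim_le_card'[of "{x}"] by simp
  ultimately have "span {x} \<subset> span P"
    using P by (metis dim_span numeral_le_one_iff psubsetI semiring_norm(69) span_eq_iff)
  then obtain z where z: "z \<noteq> 0" "z \<in> span P" "\<And>y. y \<in> span {x} \<Longrightarrow> orthogonal z y"
    using orthogonal_to_subspace_exists_gen by blast
  define e where "e = z /\<^sub>R norm z"
  have e: "norm e = 1" "e \<in> P"
    using z P by (simp_all add: e_def subspace_scale span_eq_iff[THEN iffD2])
  have xe: "x \<bullet> e = 0"
    using z(3)[of x] by (simp add: e_def orthogonal_def span_base inner_commute)
  have ne: "x \<noteq> e"
    using x xe by (auto simp: norm_eq_1)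
  have ind: "independent {x, e}"
    using x e xe by (intro pairwise_orthogonal_independent)
      (auto simp: pairwise_def orthogonal_def inner_commute)
  have "P \<subseteq> span {x, e}"
    using P x e ne ind by (intro card_ge_dim_independent) auto
  moreover have "y = (y \<bullet> x) *\<^sub>R x + (y \<bullet> e) *\<^sub>R e" if y: "y \<in> span {x, e}" for y
  proof -
    obtain k l where "y - k *\<^sub>R x - l *\<^sub>R e = 0"
      using y by (auto simp: span_breakdown_eq)
    then have "y = k *\<^sub>R x + l *\<^sub>R e"
      by (simp add: algebra_simps)
    then show ?thesis
      using x e xe by (simp add: inner_add_left norm_eq_1 inner_commute[of e x])
  qed
  ultimately show ?thesis
    using that e xe by blast
qed

text \<open>
  In an orthonormal frame of the plane, with coordinates \<open>u\<close>, \<open>v\<close>, the angular velocity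
  \<open>u v' - v u'\<close> has constant square because the speed is constant; being continuous, it is itself
  constant, and the curve solves the linear system of a uniform rotation.
\<close>

lemma geodesic_segment_circular_arc:
  fixes \<gamma> :: "real \<Rightarrow> 'a::euclidean_space"
  assumes "geodesic_segment a b \<gamma>"
  obtains w e where "w \<ge> 0" "norm e = 1" "\<gamma> a \<bullet> e = 0"
    "\<And>t. t \<in> {a..b} \<Longrightarrow> \<gamma> t = cos (w * (t - a)) *\<^sub>R \<gamma> a + sin (w * (t - a)) *\<^sub>R e"
    "arc_length a b \<gamma> = w * (b - a)"
proof -
  obtain P \<gamma>' c where ab: "a \<le> b" and P: "subspace P" "dim P = 2"
    and im: "\<And>t. t \<in> {a..b} \<Longrightarrow> \<gamma> t \<in> P" "\<And>t. t \<in> {a..b} \<Longrightarrow> norm (\<gamma> t) = 1"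
    and cont: "continuous_on {a..b} \<gamma>'"
    and der: "\<And>t. t \<in> {a..b} \<Longrightarrow> (\<gamma> has_vector_derivative \<gamma>' t) (at t within {a..b})"
    and speed: "\<And>t. t \<in> {a..b} \<Longrightarrow> norm (\<gamma>' t) = c"
    using assms unfolding geodesic_segment_def image_subset_iff by auto
  show ?thesis
  proof (cases "a = b")
    case True
    obtain e where e: "norm e = 1" "\<gamma> a \<bullet> e = 0"
      using subspace_dim_2_orthonormal_frame[OF P, of "\<gamma> a"] im True by auto
    show ?thesis
      by (rule that[of 0 e]) (use e True in \<open>auto simp: arc_length_def\<close>)
  next
    case False
    then have "a < b" using ab by simp
    define x where "x = \<gamma> a"
    have x: "x \<in> P" "norm x = 1"
      using im ab by (auto simp: x_def)
    obtain e where e: "norm e = 1" "x \<bullet> e = 0"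
      and frame: "\<And>y. y \<in> P \<Longrightarrow> y = (y \<bullet> x) *\<^sub>R x + (y \<bullet> e) *\<^sub>R e"
      using subspace_dim_2_orthonormal_frame[OF P x] by blast
    have frame_norm: "(norm (r *\<^sub>R x + s *\<^sub>R e))\<^sup>2 = r\<^sup>2 + s\<^sup>2" for r s
      using x e inner_commute[of e x]
      by (simp add: power2_norm_eq_inner norm_eq_1 inner_add_left inner_add_right)
        (simp add: power2_eq_square)
    define u v where "u = (\<lambda>t. \<gamma> t \<bullet> x)" and "v = (\<lambda>t. \<gamma> t \<bullet> e)"
    define u' v' where "u' = (\<lambda>t. \<gamma>' t \<bullet> x)" and "v' = (\<lambda>t. \<gamma>' t \<bullet> e)"
    have du: "(u has_real_derivative u' t) (at t within {a..b})" if "t \<in> {a..b}" for t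
      using der[OF that] unfolding u_def u'_def has_real_derivative_iff_has_vector_derivative
      by (rule bounded_linear.has_vector_derivative[OF bounded_linear_inner_left])
    have dv: "(v has_real_derivative v' t) (at t within {a..b})" if "t \<in> {a..b}" for t
      using der[OF that] unfolding v_def v'_def has_real_derivative_iff_has_vector_derivative
      by (rule bounded_linear.has_vector_derivative[OF bounded_linear_inner_left])
    have uv: "(u t)\<^sup>2 + (v t)\<^sup>2 = 1" if "t \<in> {a..b}" for t
      using frame_norm[of "u t" "v t"] frame[OF im(1)[OF that]] im(2)[OF that]
      by (simp add: u_def v_def)
    have \<gamma>'_frame: "\<gamma>' t = u' t *\<^sub>R x + v' t *\<^sub>R e" if t: "t \<in> {a..b}" for t
    proof -
      have "((\<lambda>t. u t *\<^sub>R x + v t *\<^sub>R e) has_vector_derivative u' t *\<^sub>R x + v' t *\<^sub>R e)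
          (at t within {a..b})"
        using has_vector_derivative_add[OF
            has_vector_derivative_scaleR[OF du[OF t] has_vector_derivative_const[of x]]
            has_vector_derivative_scaleR[OF dv[OF t] has_vector_derivative_const[of e]]]
        by simp
      then have "(\<gamma> has_vector_derivative u' t *\<^sub>R x + v' t *\<^sub>R e) (at t within {a..b})"
        by (rule has_vector_derivative_transform[OF t, rotated])
          (use frame im(1) in \<open>simp add: u_def v_def\<close>)
      with der[OF t] show ?thesis
        using vector_derivative_within_closed_interval[OF \<open>a < b\<close> t] by metis
    qed
    have uv': "(u' t)\<^sup>2 + (v' t)\<^sup>2 = c\<^sup>2" if "t \<in> {a..b}" for t
      using frame_norm[of "u' t" "v' t"] \<gamma>'_frame[OF that] speed[OF that] by simp
    have orth: "u t * u' t + v t * v' t = 0" if t: "t \<in> {a..b}" for t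
    proof -
      have "((\<lambda>t. (u t)\<^sup>2 + (v t)\<^sup>2) has_real_derivative 2 * (u t * u' t + v t * v' t))
          (at t within {a..b})"
        by (rule derivative_eq_intros du[OF t] dv[OF t] refl)+ (simp add: algebra_simps)
      moreover have "((\<lambda>t. (u t)\<^sup>2 + (v t)\<^sup>2) has_real_derivative 0) (at t within {a..b})"
        unfolding has_real_derivative_iff_has_vector_derivative
        by (rule has_vector_derivative_transform[OF t uv]) auto
      ultimately have "2 * (u t * u' t + v t * v' t) = 0"
        using vector_derivative_within_closed_interval[OF \<open>a < b\<close> t]
        unfolding has_real_derivative_iff_has_vector_derivative by metis
      then show ?thesis by simp
    qed
    define \<omega> where "\<omega> = (\<lambda>t. u t * v' t - v t * u' t)"
    have \<omega>_sq: "(\<omega> t)\<^sup>2 = c\<^sup>2" if t: "t \<in> {a..b}" for t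
    proof -
      have "(\<omega> t)\<^sup>2 + (u t * u' t + v t * v' t)\<^sup>2 = ((u t)\<^sup>2 + (v t)\<^sup>2) * ((u' t)\<^sup>2 + (v' t)\<^sup>2)"
        by (simp add: \<omega>_def power2_eq_square algebra_simps)
      then show ?thesis
        using uv[OF t] uv'[OF t] orth[OF t] by simp
    qed
    have "continuous_on {a..b} \<gamma>"
      using der by (rule continuous_on_vector_derivative)
    then have "continuous_on {a..b} \<omega>"
      unfolding \<omega>_def u_def v_def u'_def v'_def using cont by (intro continuous_intros)
    moreover have "\<omega> ` {a..b} \<subseteq> {c, - c}"
      using \<omega>_sq unfolding power2_eq_iff by blast
    then have "finite (\<omega> ` {a..b})"
      by (rule finite_subset) simp
    ultimately have "\<omega> constant_on {a..b}"
      by (intro continuous_finite_range_constant) auto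
    then obtain k where k: "\<And>t. t \<in> {a..b} \<Longrightarrow> \<omega> t = k"
      unfolding constant_on_def by blast
    have "c \<ge> 0"
      using speed[of a] ab by auto
    moreover have "k\<^sup>2 = c\<^sup>2"
      using k[of a] \<omega>_sq[of a] ab by auto
    ultimately have ck: "c = \<bar>k\<bar>"
      by (metis real_sqrt_abs abs_of_nonneg)
    have u'_eq: "u' t = - k * v t" and v'_eq: "v' t = k * u t" if t: "t \<in> {a..b}" for t
      using uv[OF t] orth[OF t] k[OF t] unfolding \<omega>_def by algebra+
    \<comment> \<open>Rotating the frame back by the angle \<open>k (t - a)\<close> makes the coordinates stationary.\<close>
    define U where "U = (\<lambda>t. u t * cos (k * (t - a)) + v t * sin (k * (t - a)))"
    define V where "V = (\<lambda>t. v t * cos (k * (t - a)) - u t * sin (k * (t - a)))"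
    have "(U has_real_derivative 0) (at t within {a..b})" if t: "t \<in> {a..b}" for t
      unfolding U_def
      by (rule derivative_eq_intros du[OF t] dv[OF t] refl)+
        (simp add: u'_eq[OF t] v'_eq[OF t] algebra_simps)
    then obtain U0 where U0: "\<And>t. t \<in> {a..b} \<Longrightarrow> U t = U0"
      using has_vector_derivative_zero_constant[of "{a..b}" U]
      unfolding has_real_derivative_iff_has_vector_derivative by auto
    have "(V has_real_derivative 0) (at t within {a..b})" if t: "t \<in> {a..b}" for t
      unfolding V_def
      by (rule derivative_eq_intros du[OF t] dv[OF t] refl)+
        (simp add: u'_eq[OF t] v'_eq[OF t] algebra_simps)
    then obtain V0 where V0: "\<And>t. t \<in> {a..b} \<Longrightarrow> V t = V0"
      using has_vector_derivative_zero_constant[of "{a..b}" V]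
      unfolding has_real_derivative_iff_has_vector_derivative by auto
    have "u a = 1" "v a = 0"
      using x e by (simp_all add: u_def v_def norm_eq_1 flip: x_def)
    then have "U0 = 1" "V0 = 0"
      using U0[of a] V0[of a] ab by (simp_all add: U_def V_def)
    then have UV: "U t = 1" "V t = 0" if "t \<in> {a..b}" for t
      using U0 V0 that by auto
    have u_eq: "u t = cos (k * (t - a))" and v_eq: "v t = sin (k * (t - a))"
      if t: "t \<in> {a..b}" for t
      using UV[OF t] sin_cos_squared_add[of "k * (t - a)"] unfolding U_def V_def by algebra+
    have arc: "\<gamma> t = cos (k * (t - a)) *\<^sub>R x + sin (k * (t - a)) *\<^sub>R e" if "t \<in> {a..b}" for t
      using frame[OF im(1)[OF that]] u_eq[OF that] v_eq[OF that] by (simp add: u_def v_def)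
    have "arc_length a b \<gamma> = integral {a..b} (\<lambda>_. c)"
      unfolding arc_length_def
    proof (rule integral_cong)
      fix t assume t: "t \<in> {a..b}"
      show "norm (vector_derivative \<gamma> (at t within {a..b})) = c"
        using vector_derivative_within_closed_interval[OF \<open>a < b\<close> t der[OF t]] speed[OF t] by simp
    qed
    then have len: "arc_length a b \<gamma> = c * (b - a)"
      using ab by (simp add: mult.commute)
    define e' where "e' = (if k \<ge> 0 then e else - e)"
    show ?thesis
    proof (rule that[of "\<bar>k\<bar>" e'])
      show "norm e' = 1" "\<gamma> a \<bullet> e' = 0"
        using e by (simp_all add: e'_def x_def)
      show "\<gamma> t = cos (\<bar>k\<bar> * (t - a)) *\<^sub>R \<gamma> a + sin (\<bar>k\<bar> * (t - a)) *\<^sub>R e'"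
        if "t \<in> {a..b}" for t
        unfolding x_def[symmetric] arc[OF that] by (simp add: e'_def abs_if)
      show "arc_length a b \<gamma> = \<bar>k\<bar> * (b - a)"
        using len ck by simp
    qed simp
  qed
qed

lemma minimal_geodesic_segment_circular_arc:
  fixes \<gamma> :: "real \<Rightarrow> 'a::euclidean_space"
  assumes "minimal_geodesic_segment a b \<gamma>"
  obtains w e where "w \<ge> 0" "norm e = 1" "\<gamma> a \<bullet> e = 0" "w * (b - a) \<le> pi"
    "\<And>t. t \<in> {a..b} \<Longrightarrow> \<gamma> t = cos (w * (t - a)) *\<^sub>R \<gamma> a + sin (w * (t - a)) *\<^sub>R e"
proof -
  have geo: "geodesic_segment a b \<gamma>" and len: "arc_length a b \<gamma> = arccos (\<gamma> a \<bullet> \<gamma> b)"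
    using assms by (auto simp: minimal_geodesic_segment_def)
  have "a \<le> b" and norms: "norm (\<gamma> a) = 1" "norm (\<gamma> b) = 1"
    using geo by (auto simp: geodesic_segment_def image_subset_iff)
  have "\<bar>\<gamma> a \<bullet> \<gamma> b\<bar> \<le> 1"
    using Cauchy_Schwarz_ineq2[of "\<gamma> a" "\<gamma> b"] norms by simp
  then have "arc_length a b \<gamma> \<le> pi"
    unfolding len by (intro arccos_ubound) auto
  then show ?thesis
    using geodesic_segment_circular_arc[OF geo] that by metis
qed

lemma great_circle_arc_minimal:
  fixes p q :: "'a::euclidean_space"
  assumes p: "norm p = 1" and q: "norm q = 1" and pq: "p \<bullet> q = 0"
    and ab: "a \<le> b" "b - a \<le> pi"
  shows "minimal_geodesic_segment a b (\<lambda>t. cos t *\<^sub>R p + sin t *\<^sub>R q)"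
proof -
  let ?\<gamma> = "\<lambda>t. cos t *\<^sub>R p + sin t *\<^sub>R q" and ?\<gamma>' = "\<lambda>t. - sin t *\<^sub>R p + cos t *\<^sub>R q"
  have pp: "p \<bullet> p = 1" "q \<bullet> q = 1" "q \<bullet> p = 0"
    using p q pq by (auto simp: norm_eq_1 inner_commute)
  have der: "(?\<gamma> has_vector_derivative ?\<gamma>' t) (at t within {a..b})" for t
    by (auto intro!: derivative_eq_intros simp: has_vector_derivative_def algebra_simps)
  have norms: "norm (?\<gamma> t) = 1" "norm (?\<gamma>' t) = 1" for t
    using pp pq sin_cos_squared_add[of t]
    by (auto simp: norm_eq_1 inner_add_left inner_add_right inner_diff_left inner_diff_right
        power2_eq_square algebra_simps)
  have "independent {p, q}"
    using p q pp pq by (intro pairwise_orthogonal_independent)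
      (auto simp: pairwise_def orthogonal_def)
  moreover have "p \<noteq> q"
    using pp pq by auto
  ultimately have "dim (span {p, q}) = 2"
    by (simp add: dim_eq_card_independent)
  then have "geodesic_segment a b ?\<gamma>"
    unfolding geodesic_segment_def using ab der norms
    by (intro conjI exI[of _ "span {p, q}"] exI[of _ ?\<gamma>'] exI[of _ 1])
      (auto intro!: continuous_intros intro: span_add span_diff span_scale span_base)
  moreover have "arc_length a b ?\<gamma> = b - a"
  proof (cases "a = b")
    case False
    then have "arc_length a b ?\<gamma> = integral {a..b} (\<lambda>_. 1)"
      unfolding arc_length_def using ab(1) der norms(2)
      by (intro integral_cong) (subst vector_derivative_within_closed_interval[OF _ _ der], auto)
    then show ?thesis
      using ab by simp
  qed (simp add: arc_length_def)
  moreover have "?\<gamma> a \<bullet> ?\<gamma> b = cos (b - a)"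
    using pp pq by (simp add: inner_add_left inner_add_right cos_diff algebra_simps)
  ultimately show ?thesis
    using ab by (simp add: minimal_geodesic_segment_def arccos_cos)
qed

section \<open>The interior of the Lorentz cone\<close>

lemma sum_option_UNIV:
  fixes g :: "'m::finite option \<Rightarrow> 'b::comm_monoid_add"
  shows "(\<Sum>i\<in>UNIV. g i) = g None + (\<Sum>i\<in>UNIV. g (Some i))"
  by (simp add: UNIV_option_conv sum.reindex)

lemma norm_squared_option:
  fixes x :: "real ^ ('m::finite option)"
  shows "(norm x)\<^sup>2 = (x $ None)\<^sup>2 + (\<Sum>i\<in>UNIV. (x $ Some i)\<^sup>2)"
  unfolding power2_norm_eq_inner by (simp add: inner_vec_def sum_option_UNIV power2_eq_square)

text \<open>
  A point with equality leaves the cone as soon as its first coordinate is decreased.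
\<close>

lemma mem_interior_lorentz_cone:
  fixes x :: "real ^ ('m::finite option)"
  shows "x \<in> interior lorentz_cone \<longleftrightarrow> sqrt (\<Sum>i\<in>UNIV. (x $ Some i)\<^sup>2) < x $ None"
proof
  assume "x \<in> interior lorentz_cone"
  then obtain \<epsilon> where \<epsilon>: "\<epsilon> > 0" "cball x \<epsilon> \<subseteq> lorentz_cone"
    by (auto simp: mem_interior_cball)
  have "x - \<epsilon> *\<^sub>R axis None 1 \<in> cball x \<epsilon>"
    using \<epsilon>(1) by (simp add: dist_norm)
  then have "x - \<epsilon> *\<^sub>R axis None 1 \<in> lorentz_cone"
    using \<epsilon>(2) by blast
  then show "sqrt (\<Sum>i\<in>UNIV. (x $ Some i)\<^sup>2) < x $ None"
    using \<epsilon>(1) by (simp add: lorentz_cone_def axis_def)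
next
  let ?S = "{x :: real ^ ('m option). sqrt (\<Sum>i\<in>UNIV. (x $ Some i)\<^sup>2) < x $ None}"
  assume "sqrt (\<Sum>i\<in>UNIV. (x $ Some i)\<^sup>2) < x $ None"
  moreover have "open ?S"
    by (intro open_Collect_less continuous_intros)
  moreover have "?S \<subseteq> lorentz_cone"
    by (auto simp: lorentz_cone_def)
  ultimately show "x \<in> interior lorentz_cone"
    using interior_maximal[of ?S lorentz_cone] by blast
qed

lemma interior_lorentz_cone_pos:
  assumes "x \<in> interior lorentz_cone"
  shows "x $ None > 0"
proof -
  have "0 \<le> sqrt (\<Sum>i\<in>UNIV. (x $ Some i)\<^sup>2)"
    by (simp add: sum_nonneg)
  also have "\<dots> < x $ None"
    using assms by (simp only: mem_interior_lorentz_cone)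
  finally show ?thesis .
qed

lemma interior_lorentz_cone_conic:
  fixes x y :: "real ^ ('m::finite option)"
  assumes x: "x \<in> interior lorentz_cone" and y: "y \<in> interior lorentz_cone"
    and c: "\<alpha> \<ge> 0" "\<beta> \<ge> 0" "\<alpha> + \<beta> > 0"
  shows "\<alpha> *\<^sub>R x + \<beta> *\<^sub>R y \<in> interior lorentz_cone"
proof -
  let ?N = "\<lambda>z :: real ^ ('m option). L2_set (\<lambda>i. z $ Some i) UNIV"
  have N: "z \<in> interior lorentz_cone \<longleftrightarrow> ?N z < z $ None" for z :: "real ^ ('m option)"
    by (simp add: mem_interior_lorentz_cone L2_set_def)
  have "?N (\<alpha> *\<^sub>R x + \<beta> *\<^sub>R y) \<le> ?N (\<alpha> *\<^sub>R x) + ?N (\<beta> *\<^sub>R y)"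
    using L2_set_triangle_ineq[of "\<lambda>i. (\<alpha> *\<^sub>R x) $ Some i" "\<lambda>i. (\<beta> *\<^sub>R y) $ Some i" UNIV] by simp
  also have "\<dots> = \<alpha> * ?N x + \<beta> * ?N y"
    using c by (simp add: L2_set_right_distrib)
  also have "\<dots> < \<alpha> * x $ None + \<beta> * y $ None"
  proof (cases "\<alpha> = 0")
    case True
    then show ?thesis using c y by (simp add: N)
  next
    case False
    then show ?thesis using c x y
      by (intro add_less_le_mono mult_strict_left_mono mult_left_mono) (auto simp: N)
  qed
  finally show ?thesis
    by (simp add: N)
qed

lemma interior_lorentz_cone_first_coordinate:
  fixes x :: "real ^ ('m::finite option)"
  assumes "x \<in> interior lorentz_cone" "norm x = 1"
  shows "(x $ None)\<^sup>2 > 1 / 2"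
proof -
  have "(sqrt (\<Sum>i\<in>UNIV. (x $ Some i)\<^sup>2))\<^sup>2 < (x $ None)\<^sup>2"
    using assms(1) by (intro power_strict_mono) (auto simp: mem_interior_lorentz_cone sum_nonneg)
  then show ?thesis
    using norm_squared_option[of x] assms(2) by (simp add: sum_nonneg)
qed

text \<open>
  Points at angle \<open>d < \<pi>\<close> are joined by a single minimal geodesic, whose points are nonnegative
  combinations of the endpoints; antipodal points do not occur because first coordinates are positive.
\<close>

lemma spherically_convex_lorentz:
  "spherically_convex (interior lorentz_cone \<inter> sphere 0 1 :: (real ^ ('m::finite option)) set)"
  unfolding spherically_convex_def
proof (intro conjI ballI allI impI)
  show "interior lorentz_cone \<inter> sphere 0 1 \<subseteq> (sphere 0 1 :: (real ^ ('m option)) set)"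
    by blast
next
  fix x y :: "real ^ ('m option)" and a b \<gamma>
  assume xC: "x \<in> interior lorentz_cone \<inter> sphere 0 1" and yC: "y \<in> interior lorentz_cone \<inter> sphere 0 1"
    and geo: "minimal_geodesic_segment a b \<gamma> \<and> \<gamma> a = x \<and> \<gamma> b = y"
  obtain w e where w: "w \<ge> 0" "w * (b - a) \<le> pi"
    and arc: "\<And>t. t \<in> {a..b} \<Longrightarrow> \<gamma> t = cos (w * (t - a)) *\<^sub>R x + sin (w * (t - a)) *\<^sub>R e"
    using minimal_geodesic_segment_circular_arc[of a b \<gamma>] geo by metis
  have ab: "a \<le> b" and sph: "\<And>t. t \<in> {a..b} \<Longrightarrow> \<gamma> t \<in> sphere 0 1"
    using geo by (auto simp: minimal_geodesic_segment_def geodesic_segment_def image_subset_iff)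
  define d where "d = w * (b - a)"
  have y: "y = cos d *\<^sub>R x + sin d *\<^sub>R e"
    using arc[of b] geo ab by (simp add: d_def)
  have pos: "x $ None > 0" "y $ None > 0"
    using xC yC by (auto intro: interior_lorentz_cone_pos)
  have "d \<noteq> pi"
    using y pos by auto
  then have d: "0 \<le> d" "d < pi"
    using w ab by (auto simp: d_def)
  show "\<gamma> ` {a..b} \<subseteq> interior lorentz_cone \<inter> sphere 0 1"
  proof (intro image_subsetI IntI sph)
    fix t assume t: "t \<in> {a..b}"
    define s where "s = w * (t - a)"
    have s: "0 \<le> s" "s \<le> d"
      using t w unfolding s_def d_def by (auto intro: mult_left_mono)
    show "\<gamma> t \<in> interior lorentz_cone"
    proof (cases "d = 0")
      case True
      then show ?thesis
        using s arc[OF t] xC by (simp flip: s_def)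
    next
      case False
      then have sd: "sin d > 0"
        using d by (intro sin_gt_zero) auto
      have "sin (d - s) *\<^sub>R x + sin s *\<^sub>R y = sin d *\<^sub>R \<gamma> t"
        unfolding y arc[OF t] s_def[symmetric] by (simp add: sin_diff algebra_simps)
      then have "\<gamma> t = (1 / sin d) *\<^sub>R (sin (d - s) *\<^sub>R x + sin s *\<^sub>R y)"
        using sd by simp
      then have "\<gamma> t = (sin (d - s) / sin d) *\<^sub>R x + (sin s / sin d) *\<^sub>R y"
        by (simp add: scaleR_add_right)
      moreover have nonneg: "sin (d - s) \<ge> 0" "sin s \<ge> 0"
        using s d by (auto intro!: sin_ge_zero)
      moreover have "sin (d - s) + sin s > 0"
      proof (cases "s = 0")
        case True
        then show ?thesis using sd by simp
      next
        case False
        then show ?thesis using s d nonneg(1) by (intro add_nonneg_pos sin_gt_zero) auto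
      qed
      ultimately show ?thesis
        using xC yC sd
        by (auto intro!: interior_lorentz_cone_conic simp flip: add_divide_distrib)
    qed
  qed
qed

section \<open>Sufficiency: the quadratic form of a block-diagonal matrix\<close>

lemma quadratic_form_block_diag:
  fixes x :: "real ^ ('m::finite option)"
  assumes "norm x = 1"
  shows "(block_diag a (lam *\<^sub>R mat 1) *v x) \<bullet> x = lam - (lam - a) * (x $ None)\<^sup>2"
proof -
  have "(block_diag a (lam *\<^sub>R mat 1) *v x) $ None = a * x $ None"
    by (simp add: matrix_vector_mult_def sum_option_UNIV block_diag_def)
  moreover have "(block_diag a (lam *\<^sub>R mat 1) *v x) $ Some i = lam * x $ Some i" for i
    by (simp add: matrix_vector_mult_def sum_option_UNIV block_diag_def mat_def if_distrib
        if_distribR sum.delta cong: if_cong)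
  ultimately have "(block_diag a (lam *\<^sub>R mat 1) *v x) \<bullet> x
      = a * (x $ None)\<^sup>2 + lam * (\<Sum>i\<in>UNIV. (x $ Some i)\<^sup>2)"
    by (simp add: inner_vec_def sum_option_UNIV power2_eq_square sum_distrib_left mult.assoc)
  moreover have "(\<Sum>i\<in>UNIV. (x $ Some i)\<^sup>2) = 1 - (x $ None)\<^sup>2"
    using norm_squared_option[of x] assms by simp
  ultimately show ?thesis
    by (simp add: algebra_simps)
qed

lemma bessel_two:
  fixes p q e :: "'a::euclidean_space"
  assumes "norm p = 1" "norm q = 1" "p \<bullet> q = 0" "norm e = 1"
  shows "(e \<bullet> p)\<^sup>2 + (e \<bullet> q)\<^sup>2 \<le> 1"
proof -
  let ?r = "e - (e \<bullet> p) *\<^sub>R p - (e \<bullet> q) *\<^sub>R q"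
  have "?r \<bullet> ?r = 1 - (e \<bullet> p)\<^sup>2 - (e \<bullet> q)\<^sup>2"
    using assms by (simp add: norm_eq_1 inner_diff_left inner_diff_right inner_commute
        power2_eq_square algebra_simps)
  then show ?thesis
    using inner_ge_zero[of ?r] by linarith
qed

lemma convex_on_transform:
  assumes f: "convex_on S f" and eq: "\<And>x. x \<in> S \<Longrightarrow> g x = f x"
  shows "convex_on S g"
  unfolding convex_on_def
proof (intro conjI ballI allI impI)
  show S: "convex S"
    using f by (rule convex_on_imp_convex)
  fix x y and u v :: real
  assume "x \<in> S" "y \<in> S" "0 \<le> u" "0 \<le> v" "u + v = 1"
  then show "g (u *\<^sub>R x + v *\<^sub>R y) \<le> u * g x + v * g y"
    using f convexD[OF S, of x y u v] by (simp add: eq convex_on_def)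
qed

text \<open>
  Along a unit-speed geodesic the first coordinate \<open>g\<close> satisfies \<open>g'' = - g\<close> and
  \<open>g\<^sup>2 + g'\<^sup>2 \<le> 1\<close>, so \<open>(g\<^sup>2)'' = 2 (g'\<^sup>2 - g\<^sup>2) \<le> 0\<close> wherever \<open>g\<^sup>2 \<ge> 1/2\<close>.
\<close>

lemma neg_square_first_coordinate_convex_on:
  fixes \<gamma> :: "real \<Rightarrow> real ^ ('m::finite option)"
  assumes geo: "minimal_geodesic_segment a b \<gamma>"
    and C: "\<gamma> ` {a..b} \<subseteq> interior lorentz_cone \<inter> sphere 0 1"
  shows "convex_on {a..b} (\<lambda>t. - (\<gamma> t $ None)\<^sup>2)"
proof -
  have ab: "a \<le> b"
    using geo by (simp add: minimal_geodesic_segment_def geodesic_segment_def)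
  obtain w e where e: "norm e = 1" "\<gamma> a \<bullet> e = 0"
    and arc: "\<And>t. t \<in> {a..b} \<Longrightarrow> \<gamma> t = cos (w * (t - a)) *\<^sub>R \<gamma> a + sin (w * (t - a)) *\<^sub>R e"
    using minimal_geodesic_segment_circular_arc[OF geo] by metis
  define p q where "p = \<gamma> a $ None" and "q = e $ None"
  have "norm (\<gamma> a) = 1"
    using geo by (auto simp: minimal_geodesic_segment_def geodesic_segment_def image_subset_iff)
  then have pq: "p\<^sup>2 + q\<^sup>2 \<le> 1"
    using bessel_two[of "\<gamma> a" e "axis None 1"] e
    by (simp add: p_def q_def norm_axis_1 inner_axis' )
  define g where "g = (\<lambda>t. p * cos (w * (t - a)) + q * sin (w * (t - a)))"
  define h where "h = (\<lambda>t. - p * sin (w * (t - a)) + q * cos (w * (t - a)))"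
  have dg: "(g has_real_derivative w * h t) (at t)" for t
    unfolding g_def h_def by (auto intro!: derivative_eq_intros simp: algebra_simps)
  have dh: "(h has_real_derivative - w * g t) (at t)" for t
    unfolding g_def h_def by (auto intro!: derivative_eq_intros simp: algebra_simps)
  have g: "\<gamma> t $ None = g t" if "t \<in> {a..b}" for t
    using arc[OF that] by (simp add: g_def p_def q_def mult.commute)
  have "convex_on {a..b} (\<lambda>t. - (g t)\<^sup>2)"
  proof (rule f''_ge0_imp_convex)
    fix t assume t: "t \<in> {a..b}"
    show "((\<lambda>t. - (g t)\<^sup>2) has_real_derivative - 2 * w * (g t * h t)) (at t)"
      by (rule derivative_eq_intros dg refl)+ simp
    show "((\<lambda>t. - 2 * w * (g t * h t)) has_real_derivative 2 * w\<^sup>2 * ((g t)\<^sup>2 - (h t)\<^sup>2)) (at t)"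
      by (rule derivative_eq_intros dg dh refl)+ (simp add: power2_eq_square algebra_simps)
    have "(g t)\<^sup>2 + (h t)\<^sup>2 = p\<^sup>2 + q\<^sup>2"
      using sin_cos_squared_add[of "w * (t - a)"] unfolding g_def h_def by algebra
    moreover have "(g t)\<^sup>2 > 1 / 2"
    proof -
      have "\<gamma> t \<in> interior lorentz_cone" "norm (\<gamma> t) = 1"
        using C t by (auto simp: image_subset_iff)
      then show ?thesis
        using interior_lorentz_cone_first_coordinate[of "\<gamma> t"] g[OF t] by simp
    qed
    ultimately have "(g t)\<^sup>2 - (h t)\<^sup>2 \<ge> 0"
      using pq by linarith
    then show "2 * w\<^sup>2 * ((g t)\<^sup>2 - (h t)\<^sup>2) \<ge> 0"
      by simp
  qed simp
  then show ?thesis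
    by (rule convex_on_transform) (simp add: g)
qed

lemma block_diag_spherically_convex_on:
  assumes "lam \<ge> a"
  shows "spherically_convex_on (interior lorentz_cone \<inter> sphere 0 1)
    (\<lambda>x :: real ^ ('m::finite option). (block_diag a (lam *\<^sub>R mat 1) *v x) \<bullet> x)"
  unfolding spherically_convex_on_def
proof (intro conjI allI impI spherically_convex_lorentz)
  fix r s and \<gamma> :: "real \<Rightarrow> real ^ ('m option)"
  assume geo: "minimal_geodesic_segment r s \<gamma> \<and> \<gamma> ` {r..s} \<subseteq> interior lorentz_cone \<inter> sphere 0 1"
  have "convex_on {r..s} (\<lambda>t. lam + (lam - a) * - (\<gamma> t $ None)\<^sup>2)"
    using assms geo
    by (intro convex_on_add convex_on_cmul neg_square_first_coordinate_convex_on)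
      (auto simp: convex_on_const)
  then show "convex_on {r..s} ((\<lambda>x. (block_diag a (lam *\<^sub>R mat 1) *v x) \<bullet> x) \<circ> \<gamma>)"
  proof (rule convex_on_transform)
    fix t assume "t \<in> {r..s}"
    then have "norm (\<gamma> t) = 1"
      using geo by (auto simp: image_subset_iff)
    then show "((\<lambda>x. (block_diag a (lam *\<^sub>R mat 1) *v x) \<bullet> x) \<circ> \<gamma>) t
      = lam + (lam - a) * - (\<gamma> t $ None)\<^sup>2"
      by (simp add: quadratic_form_block_diag)
  qed
qed

section \<open>Necessity: orthogonal pairs on the boundary of the cone\<close>

text \<open>
  The right-hand side minus the left-hand side is half the second derivative at \<open>p\<close> along the
  geodesic in direction \<open>q\<close>. Comparing \<open>p\<close>, as midpoint of a short arc, with the two ends yields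
  its sign without differentiating.
\<close>

lemma spherically_convex_on_quadratic_form_unit:
  fixes A :: "real ^ ('m::finite option) ^ ('m option)"
  assumes conv: "spherically_convex_on (interior lorentz_cone \<inter> sphere 0 1) (\<lambda>x. (A *v x) \<bullet> x)"
    and p: "p \<in> interior lorentz_cone" "norm p = 1" and q: "norm q = 1" "p \<bullet> q = 0"
  shows "(A *v p) \<bullet> p \<le> (A *v q) \<bullet> q"
proof -
  define \<gamma> where "\<gamma> = (\<lambda>t. cos t *\<^sub>R p + sin t *\<^sub>R q)"
  have "isCont \<gamma> 0"
    unfolding \<gamma>_def by (intro continuous_intros)
  then have "(\<gamma> \<longlongrightarrow> p) (at 0)"
    by (simp add: isCont_def \<gamma>_def)
  then have "\<forall>\<^sub>F t in at 0. \<gamma> t \<in> interior lorentz_cone"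
    using p(1) by (intro topological_tendstoD) auto
  then obtain \<epsilon> where \<epsilon>: "\<epsilon> > 0"
    and near: "\<And>t. t \<noteq> 0 \<Longrightarrow> \<bar>t\<bar> < \<epsilon> \<Longrightarrow> \<gamma> t \<in> interior lorentz_cone"
    by (auto simp: eventually_at dist_norm)
  define \<delta> where "\<delta> = min 1 (\<epsilon> / 2)"
  have \<delta>: "0 < \<delta>" "\<delta> \<le> 1" "\<delta> < \<epsilon>"
    using \<epsilon> by (auto simp: \<delta>_def)
  have "minimal_geodesic_segment (- \<delta>) \<delta> \<gamma>"
    unfolding \<gamma>_def using p q \<delta> pi_gt3 by (intro great_circle_arc_minimal) auto
  moreover from this have "\<gamma> ` {- \<delta>..\<delta>} \<subseteq> sphere 0 1"
    by (auto simp: minimal_geodesic_segment_def geodesic_segment_def)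
  moreover have "\<gamma> t \<in> interior lorentz_cone" if "t \<in> {- \<delta>..\<delta>}" for t
    using near[of t] p(1) that \<delta> by (cases "t = 0") (auto simp: \<gamma>_def)
  ultimately have "convex_on {- \<delta>..\<delta>} ((\<lambda>x. (A *v x) \<bullet> x) \<circ> \<gamma>)"
    using conv unfolding spherically_convex_on_def by blast
  from convex_onD[OF this, of "1/2" "- \<delta>" \<delta>]
  have "2 * ((A *v p) \<bullet> p) \<le> (A *v \<gamma> (- \<delta>)) \<bullet> \<gamma> (- \<delta>) + (A *v \<gamma> \<delta>) \<bullet> \<gamma> \<delta>"
    using \<delta> by (simp add: \<gamma>_def[of])
  also have "\<dots> = 2 * ((cos \<delta>)\<^sup>2 * ((A *v p) \<bullet> p) + (sin \<delta>)\<^sup>2 * ((A *v q) \<bullet> q))"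
    by (simp add: \<gamma>_def matrix_vector_right_distrib matrix_vector_mult_diff_distrib
        matrix_vector_mult_scaleR inner_add_left inner_add_right inner_diff_left inner_diff_right
        power2_eq_square algebra_simps)
  finally have "(sin \<delta>)\<^sup>2 * ((A *v p) \<bullet> p) \<le> (sin \<delta>)\<^sup>2 * ((A *v q) \<bullet> q)"
    by (simp add: cos_squared_eq algebra_simps)
  moreover have "sin \<delta> > 0"
    using \<delta> pi_gt3 by (intro sin_gt_zero) auto
  ultimately show ?thesis
    by simp
qed

lemma spherically_convex_on_quadratic_form:
  fixes A :: "real ^ ('m::finite option) ^ ('m option)"
  assumes conv: "spherically_convex_on (interior lorentz_cone \<inter> sphere 0 1) (\<lambda>x. (A *v x) \<bullet> x)"
    and p: "p \<in> interior lorentz_cone" and pq: "p \<bullet> q = 0"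
  shows "(norm q)\<^sup>2 * ((A *v p) \<bullet> p) \<le> (norm p)\<^sup>2 * ((A *v q) \<bullet> q)"
proof (cases "q = 0")
  case False
  have p0: "norm p > 0"
    using interior_lorentz_cone_pos[OF p] by auto
  have "(1 / norm p) *\<^sub>R p + 0 *\<^sub>R p \<in> interior lorentz_cone"
    using p p0 by (intro interior_lorentz_cone_conic) auto
  then have "(A *v (p /\<^sub>R norm p)) \<bullet> (p /\<^sub>R norm p) \<le> (A *v (q /\<^sub>R norm q)) \<bullet> (q /\<^sub>R norm q)"
    using p0 False pq
    by (intro spherically_convex_on_quadratic_form_unit[OF conv]) (auto simp: divide_inverse)
  then show ?thesis
    using p0 False by (simp add: matrix_vector_mult_scaleR power2_eq_square field_simps)
qed simp

text \<open>
  The vector \<open>e + s u\<close> is interior for \<open>0 \<le> s < 1\<close> and orthogonal to \<open>s e - u + v\<close>; at \<open>s = 1\<close> it reaches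
  the boundary, where the inequality survives by continuity.
\<close>

lemma spherically_convex_on_boundary_pair:
  fixes A :: "real ^ ('m::finite option) ^ ('m option)"
  defines "e \<equiv> axis None 1"
  assumes conv: "spherically_convex_on (interior lorentz_cone \<inter> sphere 0 1) (\<lambda>x. (A *v x) \<bullet> x)"
    and u: "u $ None = 0" "norm u = 1" and v: "v $ None = 0" "u \<bullet> v = 0"
  shows "(2 + (norm v)\<^sup>2) * ((A *v (e + u)) \<bullet> (e + u)) \<le> 2 * ((A *v (e - u + v)) \<bullet> (e - u + v))"
proof -
  have ee: "e \<bullet> e = 1" "e \<bullet> u = 0" "u \<bullet> e = 0" "e \<bullet> v = 0" "v \<bullet> e = 0" "v \<bullet> u = 0" "u \<bullet> u = 1"
    using u v by (auto simp: e_def inner_axis inner_axis' norm_eq_1 inner_commute)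
  define F where "F s = (1 + s\<^sup>2) * ((A *v (s *\<^sub>R e - u + v)) \<bullet> (s *\<^sub>R e - u + v))
      - (1 + s\<^sup>2 + (norm v)\<^sup>2) * ((A *v (e + s *\<^sub>R u)) \<bullet> (e + s *\<^sub>R u))" for s :: real
  have "F s \<ge> 0" if s: "s \<in> {0..<1}" for s
  proof -
    have "(\<Sum>i\<in>UNIV. (u $ Some i)\<^sup>2) = 1"
      using norm_squared_option[of u] u by simp
    then have "e + s *\<^sub>R u \<in> interior lorentz_cone"
      using s u
      by (simp add: mem_interior_lorentz_cone e_def axis_def power_mult_distrib
          flip: sum_distrib_left)
    moreover have "(e + s *\<^sub>R u) \<bullet> (s *\<^sub>R e - u + v) = 0"
      using ee v by (simp add: inner_add_left inner_add_right inner_diff_right)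
    moreover have "(norm (e + s *\<^sub>R u))\<^sup>2 = 1 + s\<^sup>2"
      using ee unfolding power2_norm_eq_inner
      by (simp add: inner_add_left inner_add_right power2_eq_square)
    moreover have "(norm (s *\<^sub>R e - u + v))\<^sup>2 = 1 + s\<^sup>2 + (norm v)\<^sup>2"
      using ee v unfolding power2_norm_eq_inner
      by (simp add: inner_add_left inner_add_right inner_diff_left inner_diff_right
          power2_eq_square)
    ultimately show ?thesis
      using spherically_convex_on_quadratic_form[OF conv] unfolding F_def by fastforce
  qed
  moreover have "continuous_on (closure {0..<1}) F"
    unfolding F_def
    by (intro continuous_intros bounded_linear.continuous_on[OF matrix_vector_mul_bounded_linear])
  ultimately have "F 1 \<ge> 0"
    by (intro continuous_ge_on_closure[of "{0..<1}" F 1 0]) auto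
  then show ?thesis
    by (simp add: F_def)
qed

text \<open>For small \<open>t\<close> of the sign opposite to \<open>\<beta>\<close> the linear term would prevail.\<close>

lemma linear_coefficient_zero:
  fixes \<beta> \<kappa> :: real
  assumes "\<And>t. 0 \<le> t * \<beta> + t\<^sup>2 * \<kappa>"
  shows "\<beta> = 0"
proof (rule ccontr)
  assume \<beta>: "\<beta> \<noteq> 0"
  define t where "t = - \<beta> / (1 + \<bar>\<kappa>\<bar>)"
  have "\<bar>\<kappa>\<bar> / (1 + \<bar>\<kappa>\<bar>) < 1"
    by (simp add: divide_simps)
  then have "\<kappa> / (1 + \<bar>\<kappa>\<bar>) < 1"
    by (smt (verit) divide_right_mono)
  moreover have "t * \<beta> + t\<^sup>2 * \<kappa> = (\<beta>\<^sup>2 / (1 + \<bar>\<kappa>\<bar>)) * (\<kappa> / (1 + \<bar>\<kappa>\<bar>) - 1)"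
    by (simp add: t_def power2_eq_square right_diff_distrib)
  moreover have "\<beta>\<^sup>2 / (1 + \<bar>\<kappa>\<bar>) > 0"
    using \<beta> by simp
  ultimately have "t * \<beta> + t\<^sup>2 * \<kappa> < 0"
    by (metis diff_less_0_iff_less mult_pos_neg)
  then show False
    using assms[of t] by linarith
qed

theorem theorem2:
  fixes A :: "real ^ ('m::finite option) ^ ('m option)"
  assumes "transpose A = A"
  shows "spherically_convex_on (interior lorentz_cone \<inter> sphere 0 1) (\<lambda>x. (A *v x) \<bullet> x) \<longleftrightarrow>
    (\<exists>a lam. lam \<ge> a \<and> A = block_diag a (lam *\<^sub>R mat 1))"
proof
  assume "\<exists>a lam. lam \<ge> a \<and> A = block_diag a (lam *\<^sub>R mat 1)"
  then show "spherically_convex_on (interior lorentz_cone \<inter> sphere 0 1) (\<lambda>x. (A *v x) \<bullet> x)"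
    using block_diag_spherically_convex_on by blast
next
  assume conv: "spherically_convex_on (interior lorentz_cone \<inter> sphere 0 1) (\<lambda>x. (A *v x) \<bullet> x)"
  define B where "B x y = (A *v x) \<bullet> y" for x y
  have sym: "B x y = B y x" for x y
    using assms dot_lmul_matrix[of y A x] unfolding B_def
    by (metis inner_commute transpose_matrix_vector)
  have lin: "B (x + y) z = B x z + B y z" "B z (x + y) = B z x + B z y"
    "B (x - y) z = B x z - B y z" "B z (x - y) = B z x - B z y"
    "B (r *\<^sub>R x) z = r * B x z" "B z (r *\<^sub>R x) = r * B z x" for x y z r
    by (simp_all add: B_def matrix_vector_right_distrib matrix_vector_mult_diff_distrib
        matrix_vector_mult_scaleR inner_add_left inner_add_right inner_diff_left inner_diff_right)
  have entry: "B (axis j 1) (axis i 1) = A $ i $ j" for i j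
    by (simp add: B_def matrix_vector_mult_basis inner_axis column_def)
  define e :: "real ^ ('m option)" where "e = axis None 1"
  have pair: "(2 + (norm v)\<^sup>2) * B (e + u) (e + u) \<le> 2 * B (e - u + v) (e - u + v)"
    if "u $ None = 0" "norm u = 1" "v $ None = 0" "u \<bullet> v = 0" for u v
    using spherically_convex_on_boundary_pair[OF conv that] by (simp add: B_def e_def)
  \<comment> \<open>With \<open>v = 0\<close> the roles of \<open>e + u\<close> and \<open>e - u\<close> can be exchanged, so both have the same value.\<close>
  have Be: "B e u = 0" if "u $ None = 0" "norm u = 1" for u
    using pair[of u 0] pair[of "- u" 0] that sym[of u e] by (simp add: lin)
  have Be': "B e v = 0" if "v $ None = 0" for v
  proof (cases "v = 0")
    case False
    then have "B e (v /\<^sub>R norm v) = 0"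
      using that by (intro Be) auto
    then show ?thesis
      using False by (simp add: lin)
  qed (use lin(6)[of e 0 0] in simp)
  \<comment> \<open>Equality at \<open>e - u\<close> makes it a minimum among the directions \<open>e - u + t v\<close>, so the
      first-order term in \<open>t\<close> vanishes.\<close>
  have Buv: "B u v = 0" if uv: "u $ None = 0" "norm u = 1" "v $ None = 0" "u \<bullet> v = 0" for u v
  proof -
    have "0 \<le> t * (- 4 * B u v) + t\<^sup>2 * (2 * B v v - (norm v)\<^sup>2 * B (e + u) (e + u))" for t
      using pair[of u "t *\<^sub>R v"] uv Be'[of u] Be'[of v] sym[of v u] sym[of u e] sym[of v e]
      by (simp add: lin power2_eq_square algebra_simps)
    from linear_coefficient_zero[OF this] show ?thesis
      by simp
  qed
  define f where "f i = (axis (Some i) 1 :: real ^ ('m option))" for i :: 'm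
  have f: "f i $ None = 0" "norm (f i) = 1" for i
    by (simp_all add: f_def) (simp add: axis_def)
  have ff: "f i \<bullet> f j = (if i = j then 1 else 0)" for i j
    by (auto simp: f_def inner_axis_axis)
  have off: "B (f i) (f j) = 0" if "i \<noteq> j" for i j
    using that by (intro Buv) (auto simp: f ff)
  \<comment> \<open>The sum and the difference of two basis vectors are orthogonal.\<close>
  have diag: "B (f i) (f i) = B (f j) (f j)" for i j
  proof (cases "i = j")
    case False
    have "B ((1 / sqrt 2) *\<^sub>R (f i + f j)) (f i - f j) = 0"
    proof (rule Buv)
      have "(norm (f i + f j))\<^sup>2 = 2"
        using False by (simp add: power2_norm_eq_inner inner_add_left inner_add_right ff)
      then have "norm (f i + f j) = sqrt 2"
        by (metis norm_ge_zero real_sqrt_unique)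
      then show "norm ((1 / sqrt 2) *\<^sub>R (f i + f j)) = 1"
        by simp
    qed (use False in \<open>simp_all add: f inner_add_left inner_diff_right ff\<close>)
    then show ?thesis
      using sym[of "f i" "f j"] by (simp add: lin)
  qed simp
  define a where "a = B e e"
  \<comment> \<open>By \<open>diag\<close> the choice of the index is immaterial.\<close>
  define lam where "lam = B (f undefined) (f undefined)"
  have "e \<in> interior lorentz_cone"
    by (simp add: mem_interior_lorentz_cone e_def axis_def)
  then have "a \<le> lam"
    using spherically_convex_on_quadratic_form[OF conv, of e "f undefined"] f
    by (simp add: a_def lam_def B_def e_def norm_axis_1 inner_axis')
  moreover have "A = block_diag a (lam *\<^sub>R mat 1)"
  proof -
    have "A $ i $ j = block_diag a (lam *\<^sub>R mat 1) $ i $ j" for i j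
    proof (cases i; cases j)
      fix i' j' assume "i = Some i'" "j = Some j'"
      then show ?thesis
        using off[of j' i'] diag[of i' undefined] entry[of j i]
        by (auto simp: block_diag_def lam_def mat_def f_def)
    next
      fix i' assume "i = Some i'" "j = None"
      then show ?thesis
        using Be[OF f, of i'] entry[of j i] by (simp add: block_diag_def e_def f_def)
    next
      fix j' assume "i = None" "j = Some j'"
      then show ?thesis
        using Be[OF f, of j'] sym entry[of j i] by (simp add: block_diag_def e_def f_def)
    next
      assume "i = None" "j = None"
      then show ?thesis
        using entry[of j i] by (simp add: block_diag_def a_def e_def)
    qed
    then show ?thesis
      by (simp add: vec_eq_iff)
  qed
  ultimately show "\<exists>a lam. lam \<ge> a \<and> A = block_diag a (lam *\<^sub>R mat 1)"
    by blast
qed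

end
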